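(* Let $D$ be a quasi-symmetric 2-design with parameters $b,v,r,k,\lambda$, intersection numbers $\lambda_1<\lambda_2$ and defect $\mu=\lambda_2-\lambda_1$, whose block graph $G$ is connected, and let $\rho,\sigma,f,g$ be the spectral parameters of $G$. Then: (a) $v=f+1$, $b=f+g+1$, $r-\lambda=(\rho-\sigma)\mu$, and $k-\lambda_1=-\sigma\mu$; (b) $\lambda_2=\lambda_1+\mu$ and $\lambda_1=\frac{1}{f+g+1}\big((f+1)(\lambda+\rho\mu)+g\sigma\mu\big)$, where $\lambda$ is one of the two roots of the quadratic equation $$x^2-\big(f+g+1-2(\rho-\sigma)\mu\big)x+(\rho-\sigma)\mu\Big((\rho-\sigma)\mu-\frac{f+g+1}{f+1}\Big)=0;$$ (c) the balance parameter $\overline{\lambda}$ of the complementary design $\overline{D}$ is the other root of this quadratic equation, and substituting it for $\lambda$ in the formulas of (a) and (b) yields the parameters $\overline{b},\overline{v},\overline{r},\overline{k},\overline{\lambda},\overline{\lambda_1},\overline{\lambda_2}$ of $\overline{D}$.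
   Context: A $2$-$(v,k,\lambda)$ design is a pair $(P,\mathbb{B})$ where $P$ is a set of $v$ points and $\mathbb{B}$ a collection of $k$-subsets (blocks) such that any two distinct points lie in exactly $\lambda$ blocks; $b=|\mathbb{B}|$ and each point lies in exactly $r$ blocks, with $bk=rv$, $r(k-1)=\lambda(v-1)$. The order of the design is $r-\lambda$. An intersection number is a number $x$ such that some two distinct blocks meet in exactly $x$ points. A quasi-symmetric 2-design is a 2-design with exactly two intersection numbers $\lambda_1<\lambda_2$; its defect is $\mu=\lambda_2-\lambda_1$. Its block graph has the blocks as vertices, two blocks adjacent iff they share exactly $\lambda_2$ points. The complement $\overline{D}$ of $D$ has the complements (in $P$) of the blocks of $D$ as blocks. For a connected strongly regular graph $G$ on $b$ vertices (not complete), its adjacency matrix has exactly three distinct eigenvalues $a>\rho>\sigma$ with multiplicities $1,f,g$ (so $f+g+1=b$, $a$ is the degree); $\rho,\sigma,f,g$ are called the spectral parameters of $G$. *)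

theory Defs
  imports "Jordan_Normal_Form.Char_Poly" "Graph_Theory.Digraph_Component"
begin

text \<open>
  Blocks form a set, so there are no repeated blocks. For quasi-symmetric designs with connected
  block graph this loses nothing: a repeated block would force \<open>\<lambda>\<^sub>2 = k\<close>, and adjacency in the
  block graph would then mean equality of the underlying point sets.
\<close>

definition two_design :: "'a set \<Rightarrow> 'a set set \<Rightarrow> nat \<Rightarrow> nat \<Rightarrow> nat \<Rightarrow> bool" where
  "two_design P \<B> v k l \<longleftrightarrow>
     finite P \<and> card P = v \<and>
     (\<forall>B\<in>\<B>. B \<subseteq> P \<and> card B = k) \<and>
     (\<forall>p\<in>P. \<forall>q\<in>P. p \<noteq> q \<longrightarrow> card {B\<in>\<B>. p \<in> B \<and> q \<in> B} = l)"

definition two_design_with_parameters ::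
    "'a set \<Rightarrow> 'a set set \<Rightarrow> nat \<Rightarrow> nat \<Rightarrow> nat \<Rightarrow> nat \<Rightarrow> nat \<Rightarrow> bool" where
  "two_design_with_parameters P \<B> b v r k l \<longleftrightarrow>
     two_design P \<B> v k l \<and> card \<B> = b \<and> (\<forall>p\<in>P. card {B\<in>\<B>. p \<in> B} = r)"

definition intersection_numbers :: "'a set set \<Rightarrow> nat set" where
  "intersection_numbers \<B> = {card (B \<inter> C) | B C. B \<in> \<B> \<and> C \<in> \<B> \<and> B \<noteq> C}"

definition quasi_symmetric_design ::
    "'a set \<Rightarrow> 'a set set \<Rightarrow> nat \<Rightarrow> nat \<Rightarrow> nat \<Rightarrow> nat \<Rightarrow> nat \<Rightarrow> nat \<Rightarrow> nat \<Rightarrow> bool" where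
  "quasi_symmetric_design P \<B> b v r k l l1 l2 \<longleftrightarrow>
     two_design_with_parameters P \<B> b v r k l \<and>
     intersection_numbers \<B> = {l1, l2} \<and> l1 < l2"

definition complement_blocks :: "'a set \<Rightarrow> 'a set set \<Rightarrow> 'a set set" where
  "complement_blocks P \<B> = (\<lambda>B. P - B) ` \<B>"

text \<open>Each undirected edge is represented by its two arcs.\<close>

definition block_graph :: "'a set set \<Rightarrow> nat \<Rightarrow> 'a set pair_pre_digraph" where
  "block_graph \<B> l2 =
     \<lparr> pverts = \<B>,
       parcs = {(B, C). B \<in> \<B> \<and> C \<in> \<B> \<and> B \<noteq> C \<and> card (B \<inter> C) = l2} \<rparr>"

text \<open>The list \<open>xs\<close> enumerates the vertices, fixing the order of the rows and columns.\<close>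

definition adjacency_matrix :: "'a pair_pre_digraph \<Rightarrow> 'a list \<Rightarrow> real mat" where
  "adjacency_matrix G xs =
     mat (length xs) (length xs) (\<lambda>(i, j). if (xs ! i, xs ! j) \<in> parcs G then 1 else 0)"

definition has_spectral_parameters ::
    "real mat \<Rightarrow> real \<Rightarrow> real \<Rightarrow> nat \<Rightarrow> nat \<Rightarrow> bool" where
  "has_spectral_parameters A \<rho> \<sigma> f g \<longleftrightarrow>
     (\<exists>a. {x. eigenvalue A x} = {a, \<rho>, \<sigma>} \<and> a > \<rho> \<and> \<rho> > \<sigma> \<and>
          order a (char_poly A) = 1 \<and> order \<rho> (char_poly A) = f \<and> order \<sigma> (char_poly A) = g)"

text \<open>
  The tuple is unique whenever it exists. Its existence for block graphs is not a hypothesis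
  anywhere; it has to be derived before the description can be used.
\<close>

definition spectral_parameters :: "real mat \<Rightarrow> real \<times> real \<times> nat \<times> nat" where
  "spectral_parameters A = (THE (\<rho>, \<sigma>, f, g). has_spectral_parameters A \<rho> \<sigma> f g)"

definition balance_poly :: "real \<Rightarrow> real \<Rightarrow> nat \<Rightarrow> nat \<Rightarrow> real \<Rightarrow> real poly" where
  "balance_poly \<rho> \<sigma> f g \<mu> =
     [: (\<rho> - \<sigma>) * \<mu> * ((\<rho> - \<sigma>) * \<mu> - (real f + real g + 1) / (real f + 1)),
        - (real f + real g + 1 - 2 * (\<rho> - \<sigma>) * \<mu>),
        1 :]"

end

theory Submission
  imports Defs
begin

text \<open>
  Let \<open>N\<close> be the point-block incidence matrix and \<open>A\<close> the adjacency matrix of the block graph. Then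
  \<open>N N\<^sup>T = (r - \<lambda>) I + \<lambda> J\<close> and \<open>N\<^sup>T N = (k - \<lambda>\<^sub>1) I + \<mu> A + \<lambda>\<^sub>1 J\<close>. Since \<open>N N\<^sup>T\<close> and \<open>N\<^sup>T N\<close> have
  the same nonzero spectrum and the all-one vector is a common eigenvector of \<open>N\<^sup>T N\<close> and \<open>J\<close>, the
  characteristic polynomial of \<open>A\<close> is \<open>(x - a) (x - \<rho>)\<^bsup>v - 1\<^esup> (x - \<sigma>)\<^bsup>b - v\<^esup>\<close> with
  \<open>\<rho> - \<sigma> = (r - \<lambda>) / \<mu>\<close> and \<open>\<sigma> = - (k - \<lambda>\<^sub>1) / \<mu>\<close>. Connectedness yields \<open>a > \<rho>\<close>, and \<open>b > v\<close>
  because a symmetric design has only one intersection number. The remaining identities follow from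
  \<open>b k = v r\<close> and \<open>r (k - 1) = \<lambda> (v - 1)\<close>, which also hold for the complement.
\<close>

section \<open>Determinant identities for products, all-one matrices and constant row sums\<close>

text \<open>Both sides compute \<open>t ^ m * det M\<close> for one block matrix \<open>M\<close>:
  multiplying by \<open>L 1\<close> on the right or by \<open>L t\<close> on the left clears its
  lower left block. Keeping the powers of \<open>t\<close> avoids any division.\<close>

lemma det_scalar_minus_mult_commute:
  fixes X Y :: "'a :: idom mat"
  assumes X: "X \<in> carrier_mat n m" and Y: "Y \<in> carrier_mat m n"
  shows "t ^ m * det (t \<cdot>\<^sub>m 1\<^sub>m n - X * Y) = t ^ n * det (t \<cdot>\<^sub>m 1\<^sub>m m - Y * X)"
proof -
  define M where "M = four_block_mat (t \<cdot>\<^sub>m 1\<^sub>m n) X Y (1\<^sub>m m)"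
  define L where "L u = four_block_mat (1\<^sub>m n) (0\<^sub>m n m) (- Y) (u \<cdot>\<^sub>m 1\<^sub>m m)" for u
  have M: "M \<in> carrier_mat (n + m) (n + m)" and L: "L u \<in> carrier_mat (n + m) (n + m)" for u
    using X Y by (auto simp: M_def L_def)
  have carr: "t \<cdot>\<^sub>m 1\<^sub>m n - X * Y \<in> carrier_mat n n" "t \<cdot>\<^sub>m 1\<^sub>m m - Y * X \<in> carrier_mat m m"
    using X Y by auto
  have det_L: "det (L u) = u ^ m" for u
    unfolding L_def using Y by (subst det_four_block_mat_upper_right_zero[of _ n _ m]) auto
  have "M * L 1 = four_block_mat (t \<cdot>\<^sub>m 1\<^sub>m n - X * Y) X (0\<^sub>m m n) (1\<^sub>m m)"
    unfolding M_def L_def using X Y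
    by (subst mult_four_block_mat[of _ n n _ m _ m _ _ n _ m])
       (auto intro!: cong_four_block_mat simp: minus_add_uminus_mat)
  then have "det M * det (L 1) = det (t \<cdot>\<^sub>m 1\<^sub>m n - X * Y)"
    using det_mult[OF M L, of 1] det_four_block_mat_lower_left_zero[OF carr(1) X refl, of "1\<^sub>m m"]
    by simp
  moreover have "L t * M = four_block_mat (t \<cdot>\<^sub>m 1\<^sub>m n) X (0\<^sub>m m n) (t \<cdot>\<^sub>m 1\<^sub>m m - Y * X)"
    unfolding M_def L_def using X Y
    by (subst mult_four_block_mat[of _ n n _ m _ m _ _ n _ m])
       (auto intro!: cong_four_block_mat eq_matI)
  then have "det (L t) * det M = t ^ n * det (t \<cdot>\<^sub>m 1\<^sub>m m - Y * X)"
    using det_mult[OF L M, of t] det_four_block_mat_lower_left_zero[OF _ X refl carr(2), of "t \<cdot>\<^sub>m 1\<^sub>m n"]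
    by simp
  ultimately show ?thesis by (simp add: det_L)
qed

text \<open>The constant matrix has rank at most one, being minus a column of ones times a row of
  \<open>- s\<close>. Commuting the factors leaves a determinant of size 1.\<close>

lemma det_scalar_plus_const:
  fixes t s :: "'a :: idom"
  shows "t * det (t \<cdot>\<^sub>m 1\<^sub>m n + mat n n (\<lambda>_. s)) = t ^ n * (t + of_nat n * s)"
proof -
  have eq: "t \<cdot>\<^sub>m 1\<^sub>m n - mat n 1 (\<lambda>_. 1) * mat 1 n (\<lambda>_. - s) = t \<cdot>\<^sub>m 1\<^sub>m n + mat n n (\<lambda>_. s)"
    by (rule eq_matI) (auto simp: scalar_prod_def)
  have "det (t \<cdot>\<^sub>m 1\<^sub>m 1 - mat 1 n (\<lambda>_. - s) * mat n 1 (\<lambda>_. 1)) = t + of_nat n * s"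
    by (subst det_single) (auto simp: scalar_prod_def)
  then show ?thesis
    using det_scalar_minus_mult_commute[of "mat n 1 (\<lambda>_. 1)" n 1 "mat 1 n (\<lambda>_. - s)" t]
    by (simp add: eq[simplified])
qed

text \<open>Constant row sums mean \<open>M * J = d * J\<close>, so
  \<open>M * (d I + s J) = d (M + s J)\<close>; taking determinants gives the claim. It measures the
  effect of the term \<open>l1 J\<close> when passing from \<open>N^T N\<close> to the adjacency
  matrix.\<close>

lemma det_add_const_of_row_sums:
  fixes M :: "'a :: field mat"
  assumes M: "M \<in> carrier_mat n n" and rows: "\<And>i. i < n \<Longrightarrow> (\<Sum>j<n. M $$ (i, j)) = d" and d: "d \<noteq> 0"
  shows "d * det (M + mat n n (\<lambda>_. s)) = (d + of_nat n * s) * det M"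
proof -
  have "M * (d \<cdot>\<^sub>m 1\<^sub>m n + mat n n (\<lambda>_. s)) = d \<cdot>\<^sub>m (M + mat n n (\<lambda>_. s))"
  proof (rule eq_matI)
    fix i j assume "i < dim_row (d \<cdot>\<^sub>m (M + mat n n (\<lambda>_. s)))" "j < dim_col (d \<cdot>\<^sub>m (M + mat n n (\<lambda>_. s)))"
    then have ij: "i < n" "j < n" by auto
    have "(M * (d \<cdot>\<^sub>m 1\<^sub>m n + mat n n (\<lambda>_. s))) $$ (i, j)
        = (\<Sum>m<n. M $$ (i, m) * ((if m = j then d else 0) + s))"
      using ij M by (auto simp: scalar_prod_def atLeast0LessThan intro!: sum.cong)
    also have "\<dots> = (\<Sum>m<n. (if m = j then M $$ (i, m) * d else 0)) + (\<Sum>m<n. M $$ (i, m)) * s"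
      unfolding sum_distrib_right sum.distrib[symmetric] by (intro sum.cong) (auto simp: algebra_simps)
    also have "\<dots> = d * (M $$ (i, j) + s)"
      using ij rows by (simp add: algebra_simps)
    finally show "(M * (d \<cdot>\<^sub>m 1\<^sub>m n + mat n n (\<lambda>_. s))) $$ (i, j) = (d \<cdot>\<^sub>m (M + mat n n (\<lambda>_. s))) $$ (i, j)"
      using ij M by simp
  qed (use M in auto)
  then have "det M * det (d \<cdot>\<^sub>m 1\<^sub>m n + mat n n (\<lambda>_. s)) = d ^ n * det (M + mat n n (\<lambda>_. s))"
    using M by (subst det_mult[symmetric, of _ n]) auto
  then have "det M * (d * det (d \<cdot>\<^sub>m 1\<^sub>m n + mat n n (\<lambda>_. s))) = d ^ n * (d * det (M + mat n n (\<lambda>_. s)))"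
    by (simp add: algebra_simps)
  then have "d ^ n * ((d + of_nat n * s) * det M) = d ^ n * (d * det (M + mat n n (\<lambda>_. s)))"
    unfolding det_scalar_plus_const by (simp add: algebra_simps)
  then show ?thesis using d by simp
qed

lemma poly_char_poly_eq_det:
  fixes A :: "'a :: field mat"
  assumes "A \<in> carrier_mat n n"
  shows "poly (char_poly A) x = det (x \<cdot>\<^sub>m 1\<^sub>m n - A)"
proof -
  have "- char_matrix A x = x \<cdot>\<^sub>m 1\<^sub>m n - A"
    using assms by (auto simp: char_matrix_def intro!: eq_matI)
  then show ?thesis by (simp add: char_poly_matrix[OF assms])
qed

lemma sum_nth_distinct:
  assumes "distinct xs"
  shows "(\<Sum>i<length xs. h (xs ! i)) = sum h (set xs)"
proof -
  have "bij_betw (\<lambda>i. xs ! i) {..<length xs} (set xs)"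
    using assms by (rule bij_betw_nth) auto
  then show ?thesis by (rule sum.reindex_bij_betw)
qed

text \<open>The order \<open>a > \<rho> > \<sigma>\<close> makes \<open>a\<close> the maximum and
  \<open>\<sigma>\<close> the minimum of the set of eigenvalues, and \<open>\<rho>\<close> is what
  remains; the multiplicities follow. So any tuple shown to qualify is the one described.\<close>

lemma spectral_parameters_eqI:
  assumes "has_spectral_parameters A \<rho> \<sigma> f g"
  shows "spectral_parameters A = (\<rho>, \<sigma>, f, g)"
proof -
  have "\<rho>' = \<rho> \<and> \<sigma>' = \<sigma> \<and> f' = f \<and> g' = g" if h: "has_spectral_parameters A \<rho>' \<sigma>' f' g'" for \<rho>' \<sigma>' f' g'
  proof -
    from assms obtain a where a: "{x. eigenvalue A x} = {a, \<rho>, \<sigma>}" "a > \<rho>" "\<rho> > \<sigma>"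
      "order \<rho> (char_poly A) = f" "order \<sigma> (char_poly A) = g"
      unfolding has_spectral_parameters_def by auto
    from h obtain a' where a': "{x. eigenvalue A x} = {a', \<rho>', \<sigma>'}" "a' > \<rho>'" "\<rho>' > \<sigma>'"
      "order \<rho>' (char_poly A) = f'" "order \<sigma>' (char_poly A) = g'"
      unfolding has_spectral_parameters_def by auto
    have set_eq: "{a, \<rho>, \<sigma>} = {a', \<rho>', \<sigma>'}" using a(1) a'(1) by simp
    have "a = Max {a, \<rho>, \<sigma>}" "a' = Max {a', \<rho>', \<sigma>'}" "\<sigma> = Min {a, \<rho>, \<sigma>}" "\<sigma>' = Min {a', \<rho>', \<sigma>'}"
      using a(2,3) a'(2,3) by auto
    then have "a = a'" "\<sigma> = \<sigma>'" using set_eq by metis+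
    moreover have "\<rho> \<in> {a', \<rho>', \<sigma>'}" using set_eq by auto
    ultimately have "\<rho> = \<rho>'" using a(2,3) by auto
    with \<open>\<sigma> = \<sigma>'\<close> show ?thesis using a(4,5) a'(4,5) by simp
  qed
  then have "(case q of (\<rho>', \<sigma>', f', g') \<Rightarrow> has_spectral_parameters A \<rho>' \<sigma>' f' g') \<Longrightarrow> q = (\<rho>, \<sigma>, f, g)" for q
    by (cases q) simp
  then show ?thesis
    unfolding spectral_parameters_def using assms by (intro the_equality) simp_all
qed

section \<open>Counting in 2-designs\<close>

locale design =
  fixes P :: "'a set" and \<B> :: "'a set set" and b v r k l :: nat
  assumes design: "two_design_with_parameters P \<B> b v r k l"
begin

lemma finite_points: "finite P" and card_points: "card P = v"
  and block_subset: "B \<in> \<B> \<Longrightarrow> B \<subseteq> P" and card_block: "B \<in> \<B> \<Longrightarrow> card B = k"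
  and card_blocks: "card \<B> = b"
  and replication: "p \<in> P \<Longrightarrow> card {B \<in> \<B>. p \<in> B} = r"
  and balance: "p \<in> P \<Longrightarrow> q \<in> P \<Longrightarrow> p \<noteq> q \<Longrightarrow> card {B \<in> \<B>. p \<in> B \<and> q \<in> B} = l"
  using design unfolding two_design_with_parameters_def two_design_def by blast+

lemma finite_blocks: "finite \<B>"
  by (rule finite_subset[of _ "Pow P"]) (use finite_points block_subset in auto)

lemma finite_block: "B \<in> \<B> \<Longrightarrow> finite B"
  using block_subset finite_points by (blast intro: finite_subset)

lemma sum_replication: "p \<in> P \<Longrightarrow> (\<Sum>C\<in>\<B>. of_bool (p \<in> C) :: real) = r"
  using replication[of p] finite_blocks by (simp add: of_bool_def sum.If_cases Int_def)

lemma sum_balance: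
  assumes "p \<in> P" "q \<in> P"
  shows "(\<Sum>C\<in>\<B>. of_bool (p \<in> C) * of_bool (q \<in> C) :: real) = (if p = q then r else l)"
  using assms replication[of p] balance[of p q] finite_blocks
  by (simp flip: of_bool_conj) (auto simp: of_bool_def sum.If_cases Int_def)

lemma sum_block: "B \<in> \<B> \<Longrightarrow> (\<Sum>p\<in>P. of_bool (p \<in> B) :: real) = k"
  using card_block[of B] block_subset[of B] finite_points
  by (simp add: of_bool_def sum.If_cases Int_absorb1)

lemma sum_inter:
  assumes "B \<in> \<B>"
  shows "(\<Sum>p\<in>P. of_bool (p \<in> B) * of_bool (p \<in> C) :: real) = card (B \<inter> C)"
proof -
  have "P \<inter> {p. p \<in> B \<and> p \<in> C} = B \<inter> C" using block_subset[OF assms] by auto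
  then show ?thesis
    using finite_points by (simp flip: of_bool_conj)
qed

lemma incidence_count: "b * k = v * r"
proof -
  have "real b * real k = (\<Sum>B\<in>\<B>. \<Sum>p\<in>P. of_bool (p \<in> B))"
    by (simp add: sum_block card_blocks)
  also have "\<dots> = (\<Sum>p\<in>P. \<Sum>B\<in>\<B>. of_bool (p \<in> B))" by (rule sum.swap)
  also have "\<dots> = real v * real r" by (simp add: sum_replication card_points)
  finally show ?thesis by (simp flip: of_nat_mult)
qed

text \<open>Counts the pairs of a block through \<open>p\<close> and a point \<open>q\<close> of it.
  The case \<open>q = p\<close> is included, which turns the usual
  \<open>r (k - 1) = l (v - 1)\<close> into this form.\<close>

lemma balance_count:
  assumes "p \<in> P"
  shows "real r * real k = (real r - real l) + real v * real l"
proof -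
  have "real r * real k = (\<Sum>B\<in>\<B>. of_bool (p \<in> B) * (\<Sum>q\<in>P. of_bool (q \<in> B)))"
    using assms by (simp add: sum_block sum_replication flip: sum_distrib_right)
  also have "\<dots> = (\<Sum>q\<in>P. \<Sum>B\<in>\<B>. of_bool (p \<in> B) * of_bool (q \<in> B))"
    unfolding sum_distrib_left by (rule sum.swap)
  also have "\<dots> = (\<Sum>q\<in>P. (if p = q then real r - real l else 0) + real l)"
    using assms by (intro sum.cong) (auto simp: sum_balance)
  also have "\<dots> = (real r - real l) + real v * real l"
    using assms finite_points by (simp add: sum.distrib card_points)
  finally show ?thesis .
qed

text \<open>Entry \<open>(B, p)\<close> of \<open>N^T N N^T\<close>, evaluated through
  \<open>N N^T = (r - l) I + l J\<close>.\<close>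

lemma sum_inter_through_point:
  assumes B: "B \<in> \<B>" and p: "p \<in> P"
  shows "(\<Sum>C\<in>\<B>. real (card (B \<inter> C)) * of_bool (p \<in> C)) =
    (real r - real l) * of_bool (p \<in> B) + real k * real l"
proof -
  have "(\<Sum>C\<in>\<B>. real (card (B \<inter> C)) * of_bool (p \<in> C)) =
    (\<Sum>C\<in>\<B>. \<Sum>q\<in>P. of_bool (q \<in> B) * (of_bool (q \<in> C) * of_bool (p \<in> C)))"
    by (simp only: sum_inter[OF B, symmetric] sum_distrib_right mult.assoc)
  also have "\<dots> = (\<Sum>q\<in>P. of_bool (q \<in> B) * (\<Sum>C\<in>\<B>. of_bool (q \<in> C) * of_bool (p \<in> C)))"
    unfolding sum_distrib_left by (rule sum.swap)
  also have "\<dots> = (\<Sum>q\<in>P. (if q = p then (real r - real l) * of_bool (q \<in> B) else 0) + of_bool (q \<in> B) * real l)"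
    using p by (intro sum.cong) (auto simp: sum_balance)
  also have "\<dots> = (real r - real l) * of_bool (p \<in> B) + real k * real l"
    using p finite_points by (simp add: sum.distrib sum_block[OF B] flip: sum_distrib_right)
  finally show ?thesis .
qed

text \<open>A row sum of \<open>N^T N\<close>: the all-one vector is an eigenvector with eigenvalue
  \<open>r k\<close>.\<close>

lemma sum_inter_blocks:
  assumes B: "B \<in> \<B>"
  shows "(\<Sum>C\<in>\<B>. real (card (B \<inter> C))) = real k * real r"
proof -
  have "(\<Sum>C\<in>\<B>. real (card (B \<inter> C))) = (\<Sum>p\<in>P. \<Sum>C\<in>\<B>. of_bool (p \<in> B) * of_bool (p \<in> C))"
    unfolding sum_inter[OF B, symmetric] by (rule sum.swap)
  also have "\<dots> = (\<Sum>p\<in>P. of_bool (p \<in> B) * real r)"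
    by (intro sum.cong refl) (simp add: sum_replication flip: sum_distrib_left)
  also have "\<dots> = real k * real r" by (simp add: sum_block[OF B] flip: sum_distrib_right)
  finally show ?thesis .
qed

text \<open>A diagonal entry of \<open>(N^T N)^2\<close>, obtained by summing
  \<open>sum_inter_through_point\<close> over the points of \<open>B\<close>. Together with the row
  sum it gives the variance of the intersection sizes.\<close>

lemma sum_inter_squares:
  assumes B: "B \<in> \<B>"
  shows "(\<Sum>C\<in>\<B>. (real (card (B \<inter> C)))\<^sup>2) = (real r - real l) * real k + (real k)\<^sup>2 * real l"
proof -
  have "(\<Sum>C\<in>\<B>. (real (card (B \<inter> C)))\<^sup>2) =
    (\<Sum>C\<in>\<B>. \<Sum>p\<in>P. of_bool (p \<in> B) * (real (card (B \<inter> C)) * of_bool (p \<in> C)))"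
    unfolding power2_eq_square
    by (subst (2) sum_inter[OF B, symmetric]) (simp add: sum_distrib_left algebra_simps)
  also have "\<dots> = (\<Sum>p\<in>P. of_bool (p \<in> B) * (\<Sum>C\<in>\<B>. real (card (B \<inter> C)) * of_bool (p \<in> C)))"
    unfolding sum_distrib_left by (rule sum.swap)
  also have "\<dots> = (\<Sum>p\<in>P. of_bool (p \<in> B) * (real r - real l + real k * real l))"
    by (intro sum.cong refl) (simp add: sum_inter_through_point[OF B])
  also have "\<dots> = (real r - real l) * real k + (real k)\<^sup>2 * real l"
    unfolding sum_distrib_right[symmetric] sum_block[OF B]
    by (simp add: power2_eq_square algebra_simps)
  finally show ?thesis .
qed

text \<open>The deviations of the intersection numbers from \<open>l\<close> have square sum zero.\<close>

lemma symmetric_design_inter: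
  assumes "b = v" and B: "B \<in> \<B>" and C: "C \<in> \<B>" and "B \<noteq> C"
  shows "card (B \<inter> C) = l"
proof -
  have "P \<noteq> {}" using B C \<open>B \<noteq> C\<close> block_subset by blast
  then obtain p where p: "p \<in> P" by blast
  have "v > 0" using p finite_points card_points card_gt_0_iff by blast
  then have rk: "r = k" using incidence_count \<open>b = v\<close> by simp
  let ?d = "\<lambda>D. (real (card (B \<inter> D)) - real l)\<^sup>2"
  have "(\<Sum>D\<in>\<B>. ?d D) = (\<Sum>D\<in>\<B>. (real (card (B \<inter> D)))\<^sup>2) - 2 * real l * (\<Sum>D\<in>\<B>. real (card (B \<inter> D))) + real b * (real l)\<^sup>2"
    by (simp add: power2_diff sum.distrib sum_subtractf sum_distrib_left card_blocks algebra_simps)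
  \<comment> \<open>The last bracket vanishes by \<open>balance_count\<close>. The remaining square
    is the term of \<open>D = B\<close> itself, so nothing is left for the other blocks.\<close>
  also have "\<dots> = (real k - real l)\<^sup>2 + real l * (real r - real l + real v * real l - real r * real k)"
    unfolding sum_inter_squares[OF B] sum_inter_blocks[OF B]
    by (simp add: rk \<open>b = v\<close> power2_eq_square algebra_simps)
  also have "\<dots> = ?d B" using balance_count[OF p] card_block[OF B] by simp
  finally have "(\<Sum>D\<in>\<B> - {B}. ?d D) = 0"
    using sum.remove[OF finite_blocks B, of ?d] by simp
  then have "?d C = 0" using C \<open>B \<noteq> C\<close> finite_blocks by (subst (asm) sum_nonneg_eq_0_iff) auto
  then show ?thesis by simp
qed

section \<open>Complementary designs\<close>

text \<open>Inclusion-exclusion. The additive form avoids truncated subtraction and later yields the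
  bound \<open>2 * k \<le> v + l1\<close>.\<close>

lemma complement_card_inter:
  assumes B: "B \<in> \<B>" and C: "C \<in> \<B>"
  shows "card ((P - B) \<inter> (P - C)) + 2 * k = v + card (B \<inter> C)"
proof -
  have "card (P - (B \<union> C)) + card (B \<union> C) = v"
    using card_Diff_subset[of "B \<union> C" P] card_mono[of P "B \<union> C"] block_subset[OF B] block_subset[OF C]
      finite_points card_points finite_block[OF B] finite_block[OF C] by auto
  moreover have "card (B \<union> C) + card (B \<inter> C) = 2 * k"
    using card_Un_Int[OF finite_block[OF B] finite_block[OF C]] card_block[OF B] card_block[OF C] by simp
  moreover have "(P - B) \<inter> (P - C) = P - (B \<union> C)" by auto
  ultimately show ?thesis by simp
qed

lemma inj_on_complement: "inj_on (\<lambda>B. P - B) \<B>"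
  using block_subset by (auto simp: inj_on_def)

text \<open>Expands \<open>(1 - [p \<in> C]) * (1 - [q \<in> C])\<close> over all blocks. The case
  \<open>p = q\<close> gives the replication number of the complement, the case of distinct points
  its balance.\<close>

lemma complement_balance:
  assumes "p \<in> P" "q \<in> P"
  shows "card {B \<in> complement_blocks P \<B>. p \<in> B \<and> q \<in> B} + 2 * r = b + (if p = q then r else l)"
proof -
  have "{B \<in> complement_blocks P \<B>. p \<in> B \<and> q \<in> B} = (\<lambda>B. P - B) ` {B \<in> \<B>. p \<notin> B \<and> q \<notin> B}"
    using assms by (auto simp: complement_blocks_def)
  then have "card {B \<in> complement_blocks P \<B>. p \<in> B \<and> q \<in> B} = card {B \<in> \<B>. p \<notin> B \<and> q \<notin> B}"
    using card_image[OF inj_on_subset[OF inj_on_complement, of "{B \<in> \<B>. p \<notin> B \<and> q \<notin> B}"]] by simp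
  also have "real \<dots> = (\<Sum>C\<in>\<B>. (1 - of_bool (p \<in> C)) * (1 - of_bool (q \<in> C)))"
    using finite_blocks
    by (simp flip: of_bool_not_iff of_bool_conj) (simp add: of_bool_def sum.If_cases Int_def)
  also have "\<dots> = real b - 2 * real r + (if p = q then r else l)"
    using sum_balance[OF assms] sum_replication[OF assms(1)] sum_replication[OF assms(2)]
    by (simp add: algebra_simps sum.distrib sum_subtractf card_blocks)
  finally show ?thesis by (simp split: if_splits)
qed

lemma complement_design:
  "two_design_with_parameters P (complement_blocks P \<B>) b v (b - r) (v - k) (b + l - 2 * r)"
  unfolding two_design_with_parameters_def two_design_def
proof (intro conjI ballI impI)
  show "card (complement_blocks P \<B>) = b"
    unfolding complement_blocks_def by (simp add: card_image[OF inj_on_complement] card_blocks)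
  show "card B = v - k" if "B \<in> complement_blocks P \<B>" for B
    using that block_subset card_block card_points finite_block
    by (auto simp: complement_blocks_def card_Diff_subset)
  show "card {B \<in> complement_blocks P \<B>. p \<in> B \<and> q \<in> B} = b + l - 2 * r" if "p \<in> P" "q \<in> P" "p \<noteq> q" for p q
    using complement_balance[OF that(1,2)] that(3) by simp
  show "card {B \<in> complement_blocks P \<B>. p \<in> B} = b - r" if "p \<in> P" for p
    using complement_balance[OF that that] by simp
qed (auto simp: complement_blocks_def finite_points card_points)

end

section \<open>Quasi-symmetric designs: basic facts\<close>

locale quasi_symmetric = design +
  fixes l1 l2 :: nat
  assumes inter_numbers: "intersection_numbers \<B> = {l1, l2}" and l1_less_l2: "l1 < l2"
begin

definition defect :: real where "defect = real l2 - real l1"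

definition adj :: "'a set \<Rightarrow> 'a set \<Rightarrow> bool" where "adj B C \<longleftrightarrow> B \<noteq> C \<and> card (B \<inter> C) = l2"

text \<open>The three values solve \<open>N^T N = (k - l1) I + defect A + l1 J\<close> for an
  eigenvalue of \<open>A\<close>, given the eigenvalues \<open>r k\<close>, \<open>r - l\<close> and
  \<open>0\<close> of \<open>N^T N\<close>. Only the first belongs to the all-one vector, where
  \<open>J\<close> contributes \<open>b * l1\<close>.\<close>

definition degree_ev :: real where
  "degree_ev = (real r * real k - (real k - real l1) - real b * real l1) / defect"

definition rho_ev :: real where "rho_ev = (real r - real l - (real k - real l1)) / defect"

definition sigma_ev :: real where "sigma_ev = - (real k - real l1) / defect"

lemma defect_pos: "defect > 0"
  using l1_less_l2 by (simp add: defect_def)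

lemma inter_number_cases:
  assumes "B \<in> \<B>" "C \<in> \<B>" "B \<noteq> C"
  shows "card (B \<inter> C) = l1 \<or> card (B \<inter> C) = l2"
  using assms inter_numbers unfolding intersection_numbers_def by blast

text \<open>The entrywise form of \<open>N^T N = (k - l1) I + defect A + l1 J\<close>.\<close>

lemma card_inter_eq:
  assumes "B \<in> \<B>" "C \<in> \<B>"
  shows "real (card (B \<inter> C)) = real l1 + (if B = C then real k - real l1 else 0) + defect * of_bool (adj B C)"
  using inter_number_cases[OF assms] l1_less_l2 card_block[OF assms(1)]
  by (auto simp: adj_def defect_def)

text \<open>An intersection number comes from two distinct blocks, and blocks of equal size cannot
  contain each other properly. All nondegeneracy facts rest on this configuration.\<close>

lemma separated_points:
  obtains p q B C where "p \<in> P" "q \<in> P" "B \<in> \<B>" "C \<in> \<B>" "p \<in> B" "q \<notin> B" "q \<in> C" "p \<notin> C"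
proof -
  have "l1 \<in> intersection_numbers \<B>" using inter_numbers by simp
  then obtain B C where BC: "B \<in> \<B>" "C \<in> \<B>" "B \<noteq> C" unfolding intersection_numbers_def by auto
  have "\<not> B \<subseteq> C" "\<not> C \<subseteq> B"
    using BC card_subset_eq[OF finite_block] card_block by metis+
  then obtain p q where "p \<in> B" "p \<notin> C" "q \<in> C" "q \<notin> B" by blast
  then show ?thesis using BC block_subset by (intro that[of p q B C]) auto
qed

text \<open>The block \<open>B\<close> contains \<open>p\<close> but misses \<open>q\<close>, so the
  inclusion is strict. Positivity of the order later separates \<open>rho_ev\<close> from
  \<open>sigma_ev\<close>.\<close>

lemma l_less_r: "l < r"
proof -
  obtain p q B C where *: "p \<in> P" "q \<in> P" "B \<in> \<B>" "C \<in> \<B>" "p \<in> B" "q \<notin> B" "q \<in> C" "p \<notin> C"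
    by (rule separated_points)
  have "{D \<in> \<B>. p \<in> D \<and> q \<in> D} \<subset> {D \<in> \<B>. p \<in> D}" using * by blast
  then have "card {D \<in> \<B>. p \<in> D \<and> q \<in> D} < card {D \<in> \<B>. p \<in> D}"
    using finite_blocks by (intro psubset_card_mono) auto
  moreover have "p \<noteq> q" using * by auto
  ultimately show ?thesis using replication balance * by simp
qed

lemma two_le_v: "2 \<le> v"
proof -
  obtain p q B C where *: "p \<in> P" "q \<in> P" "B \<in> \<B>" "C \<in> \<B>" "p \<in> B" "q \<notin> B" "q \<in> C" "p \<notin> C"
    by (rule separated_points)
  then have "card {p, q} \<le> card P" using finite_points by (intro card_mono) auto
  moreover have "p \<noteq> q" using * by auto
  ultimately show ?thesis by (simp add: card_points)
qed

lemma r_mult_k: "real r * real k = (real r - real l) + real v * real l"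
  using separated_points balance_count by metis

text \<open>Equality would leave \<open>l\<close> as the only intersection number. The inequality
  \<open>v \<le> b\<close> itself comes later, from counting multiplicities.\<close>

lemma b_neq_v: "b \<noteq> v"
proof
  assume "b = v"
  have "intersection_numbers \<B> \<subseteq> {l}"
    using symmetric_design_inter[OF \<open>b = v\<close>] unfolding intersection_numbers_def by auto
  then show False using inter_numbers l1_less_l2 by auto
qed

section \<open>The spectrum of the block graph\<close>

text \<open>Regularity of the block graph is inherited from the constant row sums of
  \<open>N^T N\<close>.\<close>

lemma sum_adj:
  assumes B: "B \<in> \<B>"
  shows "(\<Sum>C\<in>\<B>. of_bool (adj B C)) = degree_ev"
proof -
  have "real k * real r = (\<Sum>C\<in>\<B>. real l1 + (if B = C then real k - real l1 else 0) + defect * of_bool (adj B C))"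
    unfolding sum_inter_blocks[OF B, symmetric] by (intro sum.cong refl card_inter_eq B)
  also have "\<dots> = real b * real l1 + (real k - real l1) + defect * (\<Sum>C\<in>\<B>. of_bool (adj B C))"
    using finite_blocks B by (simp only: sum.distrib sum_distrib_left sum_constant card_blocks sum.delta' if_True)
  finally show ?thesis using defect_pos by (simp add: degree_ev_def field_simps)
qed

text \<open>Entry \<open>(B, p)\<close> of \<open>defect A N^T\<close>. The part free of
  \<open>of_bool (p \<in> B)\<close> does not depend on \<open>p\<close>, so it cancels in the
  difference for two points and leaves an eigenvector for \<open>rho_ev\<close>.\<close>

lemma sum_adj_through_point:
  assumes B: "B \<in> \<B>" and p: "p \<in> P"
  shows "defect * (\<Sum>C\<in>\<B>. of_bool (adj B C) * of_bool (p \<in> C)) =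
    (real r - real l - (real k - real l1)) * of_bool (p \<in> B) + real k * real l - real l1 * real r"
proof -
  have "(real r - real l) * of_bool (p \<in> B) + real k * real l =
    (\<Sum>C\<in>\<B>. real l1 * of_bool (p \<in> C) + (if B = C then (real k - real l1) * of_bool (p \<in> C) else 0)
      + defect * (of_bool (adj B C) * of_bool (p \<in> C)))"
    unfolding sum_inter_through_point[OF B p, symmetric]
    by (intro sum.cong refl) (simp add: card_inter_eq[OF B] algebra_simps)
  also have "\<dots> = real l1 * real r + (real k - real l1) * of_bool (p \<in> B)
      + defect * (\<Sum>C\<in>\<B>. of_bool (adj B C) * of_bool (p \<in> C))"
    using finite_blocks B
    by (simp only: sum.distrib sum_distrib_left[symmetric] sum_replication[OF p] sum.delta' if_True)
  finally show ?thesis by (simp only: algebra_simps)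
qed

text \<open>
  The vector \<open>y C = [p \<in> C] - [q \<in> C]\<close> is an eigenvector for \<open>rho_ev\<close> with maximal entry \<open>1\<close>. If
  \<open>rho_ev\<close> were at least the degree, every neighbour of a maximal entry would be maximal too, so
  \<open>y\<close> would be constant on a connected graph.
\<close>

lemma rho_less_degree:
  assumes conn: "Digraph_Component.connected (with_proj (block_graph \<B> l2))"
  shows "rho_ev < degree_ev"
proof (rule ccontr)
  assume neg: "\<not> rho_ev < degree_ev"
  obtain p q B0 C0 where *: "p \<in> P" "q \<in> P" "B0 \<in> \<B>" "C0 \<in> \<B>" "p \<in> B0" "q \<notin> B0" "q \<in> C0" "p \<notin> C0"
    by (rule separated_points)
  define y :: "'a set \<Rightarrow> real" where "y C = of_bool (p \<in> C) - of_bool (q \<in> C)" for C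
  have y_le: "y C \<le> 1" for C by (simp add: y_def)
  have ev: "(\<Sum>C\<in>\<B>. of_bool (adj B C) * y C) = rho_ev * y B" if B: "B \<in> \<B>" for B
  proof -
    have "defect * (\<Sum>C\<in>\<B>. of_bool (adj B C) * y C) = (real r - real l - (real k - real l1)) * y B"
      using sum_adj_through_point[OF B *(1)] sum_adj_through_point[OF B *(2)]
      by (simp add: y_def right_diff_distrib sum_subtractf)
    then show ?thesis using defect_pos by (simp add: rho_ev_def field_simps)
  qed
  have neighbour: "y C = 1" if B: "B \<in> \<B>" and C: "C \<in> \<B>" and "adj B C" "y B = 1" for B C
  proof -
    \<comment> \<open>The summands are nonnegative, and by \<open>neg\<close> their total is at most
      zero, so each of them vanishes.\<close>
    have "(\<Sum>D\<in>\<B>. of_bool (adj B D) * (1 - y D)) = degree_ev - rho_ev"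
      using ev[OF B] sum_adj[OF B] \<open>y B = 1\<close> by (simp add: right_diff_distrib sum_subtractf)
    moreover have "of_bool (adj B C) * (1 - y C) \<le> (\<Sum>D\<in>\<B>. of_bool (adj B D) * (1 - y D))"
      using C finite_blocks y_le by (intro member_le_sum) auto
    ultimately show ?thesis using neg \<open>adj B C\<close> y_le[of C] by simp
  qed
  \<comment> \<open>A walk from \<open>B0\<close>, where \<open>y\<close> is 1, to
    \<open>C0\<close>, where \<open>y\<close> is -1. Since \<open>adj\<close> is symmetric, the arcs
    of the symmetric closure are still adjacencies.\<close>
  have "(B0, C0) \<in> rtrancl_on \<B> (arcs_ends (with_proj (mk_symmetric (with_proj (block_graph \<B> l2)))))"
    using conn *(3,4) unfolding connected_def strongly_connected_def reachable_def
    by (auto simp: block_graph_def)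
  then have "y C0 = 1"
  proof (induction rule: rtrancl_on_induct)
    case base
    show ?case using * by (simp add: y_def)
  next
    case (step D E)
    have "adj D E" using step.hyps
      by (auto simp: parcs_mk_symmetric block_graph_def adj_def Int_commute)
    then show ?case using \<open>D \<in> \<B>\<close> \<open>E \<in> \<B>\<close> \<open>y D = 1\<close> by (blast intro: neighbour)
  qed
  then show False using * by (simp add: y_def)
qed

text \<open>The factor \<open>[:- sigma_ev, 1:] ^ v\<close> is not cancelled because \<open>v \<le> b\<close> is only a consequence.\<close>

lemma char_poly_block_graph:
  assumes "distinct bs" "set bs = \<B>"
  defines "A \<equiv> adjacency_matrix (block_graph \<B> l2) bs"
  shows "[:- sigma_ev, 1:] ^ v * char_poly A =
    [:- sigma_ev, 1:] ^ b * ([:- rho_ev, 1:] ^ (v - 1) * [:- degree_ev, 1:])"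
proof -
  obtain ps where ps: "distinct ps" "set ps = P" using finite_distinct_list[OF finite_points] by metis
  have len: "length bs = b" "length ps = v"
    using assms(1,2) ps card_blocks card_points distinct_card by metis+
  have blk: "bs ! j \<in> \<B>" if "j < b" for j using that assms(2) len by auto
  have pt: "ps ! i \<in> P" if "i < v" for i using that ps len by auto
  have sum_bs: "(\<Sum>j<b. h (bs ! j)) = sum h \<B>" for h :: "'a set \<Rightarrow> real"
    using sum_nth_distinct[OF assms(1)] assms(2) len by simp
  have sum_ps: "(\<Sum>i<v. h (ps ! i)) = sum h P" for h :: "'a \<Rightarrow> real"
    using sum_nth_distinct[OF ps(1)] ps(2) len by simp
  have bs_eq: "bs ! i = bs ! j \<longleftrightarrow> i = j" if "i < b" "j < b" for i j
    using that nth_eq_iff_index_eq[OF assms(1)] len by simp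
  have ps_eq: "ps ! i = ps ! j \<longleftrightarrow> i = j" if "i < v" "j < v" for i j
    using that nth_eq_iff_index_eq[OF ps(1)] len by simp
  have A: "A \<in> carrier_mat b b" by (simp add: A_def adjacency_matrix_def len)
  have A_entry: "A $$ (i, j) = of_bool (adj (bs ! i) (bs ! j))" if "i < b" "j < b" for i j
    using that blk by (simp add: A_def adjacency_matrix_def len block_graph_def adj_def)
  define N :: "real mat" where "N = mat v b (\<lambda>(i, j). of_bool (ps ! i \<in> bs ! j))"
  have N: "N \<in> carrier_mat v b" by (simp add: N_def)
  have NNt: "(N * N\<^sup>T) $$ (i, j) = (if i = j then real r else real l)" if "i < v" "j < v" for i j
  proof -
    have "(N * N\<^sup>T) $$ (i, j) = (\<Sum>m<b. of_bool (ps ! i \<in> bs ! m) * of_bool (ps ! j \<in> bs ! m))"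
      using that by (simp add: N_def scalar_prod_def atLeast0LessThan)
    also have "\<dots> = (if i = j then real r else real l)"
      using sum_bs[of "\<lambda>C. of_bool (ps ! i \<in> C) * of_bool (ps ! j \<in> C)"] sum_balance[OF pt pt] that
      by (simp add: ps_eq)
    finally show ?thesis .
  qed
  have NtN: "(N\<^sup>T * N) $$ (i, j) = real (card (bs ! i \<inter> bs ! j))" if "i < b" "j < b" for i j
  proof -
    have "(N\<^sup>T * N) $$ (i, j) = (\<Sum>m<v. of_bool (ps ! m \<in> bs ! i) * of_bool (ps ! m \<in> bs ! j))"
      using that by (simp add: N_def scalar_prod_def atLeast0LessThan)
    then show ?thesis
      using sum_ps[of "\<lambda>q. of_bool (q \<in> bs ! i) * of_bool (q \<in> bs ! j)"] sum_inter[OF blk] that by simp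
  qed
  let ?S = "[:- sigma_ev, 1:]" and ?R = "[:- rho_ev, 1:]" and ?D = "[:- degree_ev, 1:]"
  \<comment> \<open>The two exclusions are the zeros of factors that get cancelled:
    \<open>y - (r - l)\<close> in the determinant on points, and the row sum \<open>y - r k\<close>
    on blocks.\<close>
  have eval: "poly (?S ^ v * char_poly A) x = poly (?S ^ b * (?R ^ (v - 1) * ?D)) x"
    if generic: "x \<noteq> rho_ev" "defect * (x - sigma_ev) \<noteq> real r * real k" for x
  proof -
    \<comment> \<open>Chosen so that \<open>defect (x I - A) = y I - N^T N + l1 J\<close>, which is
      \<open>shift\<close> below. The powers of \<open>y\<close> are never cancelled, so
      \<open>x = sigma_ev\<close> is covered.\<close>
    define y where "y = defect * (x - sigma_ev)"
    have y_rho: "y - (real r - real l) = defect * (x - rho_ev)"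
      and y_deg: "y - real r * real k + real b * real l1 = defect * (x - degree_ev)"
      and y_x: "y = defect * x + (real k - real l1)"
      using defect_pos
      by (simp_all add: y_def rho_ev_def sigma_ev_def degree_ev_def field_simps)
    have "y \<cdot>\<^sub>m 1\<^sub>m v - N * N\<^sup>T = (y - (real r - real l)) \<cdot>\<^sub>m 1\<^sub>m v + mat v v (\<lambda>_. - real l)"
      using N by (intro eq_matI) (auto simp: NNt simp del: index_mult_mat(1))
    then have "(y - (real r - real l)) * det (y \<cdot>\<^sub>m 1\<^sub>m v - N * N\<^sup>T) =
        (y - (real r - real l)) ^ v * (y - real r * real k)"
      using det_scalar_plus_const[of "y - (real r - real l)" v "- real l"]
      by (simp add: r_mult_k diff_diff_eq)
    moreover have "(y - (real r - real l)) ^ v = (y - (real r - real l)) * (y - (real r - real l)) ^ (v - 1)"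
      using two_le_v by (simp add: power_eq_if)
    ultimately have det_points: "det (y \<cdot>\<^sub>m 1\<^sub>m v - N * N\<^sup>T) = (y - (real r - real l)) ^ (v - 1) * (y - real r * real k)"
      using generic(1) defect_pos y_rho by simp
    have swap: "y ^ v * det (y \<cdot>\<^sub>m 1\<^sub>m b - N\<^sup>T * N) = y ^ b * det (y \<cdot>\<^sub>m 1\<^sub>m v - N * N\<^sup>T)"
      using N by (intro det_scalar_minus_mult_commute) auto
    have shift: "defect \<cdot>\<^sub>m (x \<cdot>\<^sub>m 1\<^sub>m b - A) = (y \<cdot>\<^sub>m 1\<^sub>m b - N\<^sup>T * N) + mat b b (\<lambda>_. real l1)"
    proof (intro eq_matI)
      fix i j assume "i < dim_row (y \<cdot>\<^sub>m 1\<^sub>m b - N\<^sup>T * N + mat b b (\<lambda>_. real l1))"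
        "j < dim_col (y \<cdot>\<^sub>m 1\<^sub>m b - N\<^sup>T * N + mat b b (\<lambda>_. real l1))"
      then have ij: "i < b" "j < b" by auto
      then show "(defect \<cdot>\<^sub>m (x \<cdot>\<^sub>m 1\<^sub>m b - A)) $$ (i, j) = (y \<cdot>\<^sub>m 1\<^sub>m b - N\<^sup>T * N + mat b b (\<lambda>_. real l1)) $$ (i, j)"
        using A N card_inter_eq[OF blk blk, OF ij]
        by (auto simp: NtN A_entry y_x bs_eq algebra_simps simp del: index_mult_mat(1))
    qed (use A N in auto)
    have rows: "(\<Sum>j<b. (y \<cdot>\<^sub>m 1\<^sub>m b - N\<^sup>T * N) $$ (i, j)) = y - real r * real k" if i: "i < b" for i
    proof -
      have "(\<Sum>j<b. (y \<cdot>\<^sub>m 1\<^sub>m b - N\<^sup>T * N) $$ (i, j)) =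
          (\<Sum>j<b. (if i = j then y else 0) - real (card (bs ! i \<inter> bs ! j)))"
        using i N by (intro sum.cong) (auto simp: NtN simp del: index_mult_mat(1))
      also have "\<dots> = y - real r * real k"
        using i sum_bs[of "\<lambda>C. real (card (bs ! i \<inter> C))"] sum_inter_blocks[OF blk[OF i]]
        by (simp add: sum_subtractf)
      finally show ?thesis .
    qed
    have "(y - real r * real k) * det (defect \<cdot>\<^sub>m (x \<cdot>\<^sub>m 1\<^sub>m b - A)) =
        (y - real r * real k + real b * real l1) * det (y \<cdot>\<^sub>m 1\<^sub>m b - N\<^sup>T * N)"
      unfolding shift using N rows generic(2)
      by (intro det_add_const_of_row_sums) (auto simp: y_def)
    then have "(y - real r * real k) * (defect ^ b * poly (char_poly A) x) =
        (y - real r * real k + real b * real l1) * det (y \<cdot>\<^sub>m 1\<^sub>m b - N\<^sup>T * N)"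
      using A by (simp add: poly_char_poly_eq_det[OF A])
    then have "(y - real r * real k) * (defect ^ b * y ^ v * poly (char_poly A) x) =
        (y - real r * real k + real b * real l1) * (y ^ v * det (y \<cdot>\<^sub>m 1\<^sub>m b - N\<^sup>T * N))"
      by (simp only: mult.assoc mult.left_commute[of _ "y ^ v"])
    also have "\<dots> = (y - real r * real k) *
        (y ^ b * (y - (real r - real l)) ^ (v - 1) * (y - real r * real k + real b * real l1))"
      unfolding swap det_points by (simp only: mult.commute mult.left_commute)
    finally have "defect ^ b * y ^ v * poly (char_poly A) x =
        y ^ b * (y - (real r - real l)) ^ (v - 1) * (y - real r * real k + real b * real l1)"
      using generic(2) by (simp add: y_def)
    also have "\<dots> = (defect ^ b * defect ^ v) * ((x - sigma_ev) ^ b * ((x - rho_ev) ^ (v - 1) * (x - degree_ev)))"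
    \<comment> \<open>The \<open>v - 1\<close> factors for \<open>rho_ev\<close> and the single
      factor for \<open>degree_ev\<close> together supply \<open>defect ^ v\<close>, matching the
      left side.\<close>
    proof -
      have "defect ^ v = defect ^ (v - 1) * defect" using two_le_v by (simp add: power_eq_if)
      then show ?thesis unfolding y_rho y_deg unfolding y_def power_mult_distrib by simp
    qed
    finally have "(defect ^ b * defect ^ v) * ((x - sigma_ev) ^ v * poly (char_poly A) x) =
        (defect ^ b * defect ^ v) * ((x - sigma_ev) ^ b * ((x - rho_ev) ^ (v - 1) * (x - degree_ev)))"
      by (simp only: y_def power_mult_distrib mult.assoc)
    then show ?thesis using defect_pos by (simp del: mult_pCons_left mult_pCons_right)
  qed
  \<comment> \<open>The point where \<open>y = r k\<close>. With only two points excluded, the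
    polynomials agree at infinitely many places and are equal.\<close>
  let ?x0 = "real r * real k / defect + sigma_ev"
  have "infinite (UNIV - {rho_ev, ?x0})"
    using infinite_UNIV_char_0 by (intro Diff_infinite_finite) auto
  moreover have "UNIV - {rho_ev, ?x0} \<subseteq> {x. poly (?S ^ v * char_poly A - ?S ^ b * (?R ^ (v - 1) * ?D)) x = 0}"
    using eval defect_pos by (auto simp: field_simps)
  ultimately have "infinite {x. poly (?S ^ v * char_poly A - ?S ^ b * (?R ^ (v - 1) * ?D)) x = 0}"
    using infinite_super by blast
  then have "?S ^ v * char_poly A - ?S ^ b * (?R ^ (v - 1) * ?D) = 0"
    using poly_roots_finite by blast
  then show ?thesis by (rule eq_iff_diff_eq_0[THEN iffD2])
qed

text \<open>Root orders are compared on both sides of \<open>char_poly_block_graph\<close>, where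
  \<open>sigma_ev < rho_ev < degree_ev\<close> keeps the three linear factors apart.\<close>

lemma spectral_parameters_block_graph:
  assumes conn: "Digraph_Component.connected (with_proj (block_graph \<B> l2))"
    and "distinct bs" "set bs = \<B>"
  shows "v < b"
    and "spectral_parameters (adjacency_matrix (block_graph \<B> l2) bs) = (rho_ev, sigma_ev, v - 1, b - v)"
proof -
  define A where "A = adjacency_matrix (block_graph \<B> l2) bs"
  let ?S = "[:- sigma_ev, 1:]" and ?R = "[:- rho_ev, 1:]" and ?D = "[:- degree_ev, 1:]"
  have cp: "?S ^ v * char_poly A = ?S ^ b * (?R ^ (v - 1) * ?D)"
    unfolding A_def by (rule char_poly_block_graph[OF assms(2,3)])
  have A: "A \<in> carrier_mat b b"
    using distinct_card[OF assms(2)] assms(3) card_blocks by (simp add: A_def adjacency_matrix_def)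
  have "char_poly A \<noteq> 0" using degree_monic_char_poly[OF A] by auto
  have sr: "sigma_ev < rho_ev"
    using defect_pos l_less_r by (simp add: sigma_ev_def rho_ev_def divide_strict_right_mono)
  have ra: "rho_ev < degree_ev" by (rule rho_less_degree[OF conn])
  have ord_lin: "order x [:- z, 1:] = (if x = z then 1 else 0)" for x z :: real
    using order_power_n_n[of x 1] by (auto intro: order_0I)
  have ord_pow: "order x ([:- z, 1:] ^ n) = n * order x [:- z, 1:]" for x z :: real and n
    by (induction n) (auto simp: order_mult order_0I simp del: mult_pCons_left mult_pCons_right)
  have "order x (?S ^ v * char_poly A) = order x (?S ^ b * (?R ^ (v - 1) * ?D))" for x
    by (simp only: cp)
  then have ord: "v * order x ?S + order x (char_poly A) = b * order x ?S + (v - 1) * order x ?R + order x ?D" for x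
    using \<open>char_poly A \<noteq> 0\<close> by (simp add: order_mult ord_pow del: mult_pCons_left mult_pCons_right)
  \<comment> \<open>This is where \<open>v \<le> b\<close> emerges; \<open>b_neq_v\<close> makes it
    strict.\<close>
  have "v + order sigma_ev (char_poly A) = b"
    using ord[of sigma_ev] sr ra by (simp add: ord_lin)
  then show "v < b" using b_neq_v by simp
  have ord_sigma: "order sigma_ev (char_poly A) = b - v"
    using \<open>v + _ = b\<close> by simp
  have ord_rho: "order rho_ev (char_poly A) = v - 1" using ord[of rho_ev] sr ra by (simp add: ord_lin)
  have ord_deg: "order degree_ev (char_poly A) = 1" using ord[of degree_ev] sr ra by (simp add: ord_lin)
  have "eigenvalue A x \<longleftrightarrow> order x (char_poly A) \<noteq> 0" for x
    using \<open>char_poly A \<noteq> 0\<close> by (simp add: eigenvalue_root_char_poly[OF A] order_root)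
  moreover have "order x (char_poly A) = 0" if "x \<notin> {degree_ev, rho_ev, sigma_ev}" for x
    using ord[of x] that by (simp add: ord_lin)
  ultimately have "{x. eigenvalue A x} = {degree_ev, rho_ev, sigma_ev}"
    using ord_sigma ord_rho ord_deg \<open>v < b\<close> two_le_v by fastforce
  \<comment> \<open>The multiplicities \<open>1\<close>, \<open>v - 1\<close> and
    \<open>b - v\<close> are all positive, so each of the three values is an eigenvalue.\<close>
  then have "has_spectral_parameters A rho_ev sigma_ev (v - 1) (b - v)"
    unfolding has_spectral_parameters_def using ord_sigma ord_rho ord_deg sr ra by blast
  then show "spectral_parameters (adjacency_matrix (block_graph \<B> l2) bs) = (rho_ev, sigma_ev, v - 1, b - v)"
    unfolding A_def by (rule spectral_parameters_eqI)
qed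

section \<open>The complement of a quasi-symmetric design\<close>

text \<open>Complementation shifts every intersection size by \<open>v - 2 k\<close>, which
  preserves the defect. The second claim ensures that the natural subtractions do not
  truncate.\<close>

lemma complement_quasi_symmetric:
  shows "quasi_symmetric_design P (complement_blocks P \<B>) b v (b - r) (v - k) (b + l - 2 * r)
      (v + l1 - 2 * k) (v + l2 - 2 * k)"
    and "2 * k \<le> v + l1"
proof -
  have l1_in: "l1 \<in> intersection_numbers \<B>" using inter_numbers by simp
  then show le: "2 * k \<le> v + l1"
    unfolding intersection_numbers_def using complement_card_inter by fastforce
  have inj: "P - B = P - C \<longleftrightarrow> B = C" if "B \<in> \<B>" "C \<in> \<B>" for B C
    using inj_onD[OF inj_on_complement _ that] by auto
  have inter: "card ((P - B) \<inter> (P - C)) = v + card (B \<inter> C) - 2 * k" if "B \<in> \<B>" "C \<in> \<B>" for B C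
    using complement_card_inter[OF that] by simp
  have "intersection_numbers (complement_blocks P \<B>) =
      {card ((P - B) \<inter> (P - C)) | B C. B \<in> \<B> \<and> C \<in> \<B> \<and> P - B \<noteq> P - C}"
    unfolding intersection_numbers_def complement_blocks_def by blast
  also have "\<dots> = {v + card (B \<inter> C) - 2 * k | B C. B \<in> \<B> \<and> C \<in> \<B> \<and> B \<noteq> C}"
    using inter inj by (intro Collect_cong) metis
  also have "\<dots> = (\<lambda>x. v + x - 2 * k) ` intersection_numbers \<B>"
    unfolding intersection_numbers_def by blast
  also have "\<dots> = {v + l1 - 2 * k, v + l2 - 2 * k}" by (simp add: inter_numbers)
  finally show "quasi_symmetric_design P (complement_blocks P \<B>) b v (b - r) (v - k) (b + l - 2 * r)
      (v + l1 - 2 * k) (v + l2 - 2 * k)"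
    unfolding quasi_symmetric_design_def using complement_design le l1_less_l2 by auto
qed

lemma complement_bounds: "r \<le> b" "2 * r \<le> b + l" "k \<le> v"
proof -
  obtain p q B C where *: "p \<in> P" "q \<in> P" "B \<in> \<B>" "C \<in> \<B>" "p \<in> B" "q \<notin> B" "q \<in> C" "p \<notin> C"
    by (rule separated_points)
  show "2 * r \<le> b + l" using complement_balance[OF *(1,2)] * by (auto split: if_splits)
  show "r \<le> b" using complement_balance[OF *(1,1)] by simp
  show "k \<le> v" using card_mono[OF finite_points block_subset[OF *(3)]] card_block[OF *(3)] card_points by simp
qed

end

section \<open>Parameter identities and the quadratic equation\<close>

text \<open>Eliminating \<open>r\<close> and \<open>k\<close> from \<open>b k = v r\<close> leaves a
  linear equation for \<open>l1\<close>. It is stated for real numbers so that it serves the design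
  and its complement alike.\<close>

lemma inter_number_formula:
  fixes b v r k l l1 f g \<rho> \<sigma> \<mu> :: real
  assumes "b * k = v * r" "v = f + 1" "b = f + g + 1" "b \<noteq> 0"
    "r - l = (\<rho> - \<sigma>) * \<mu>" "k - l1 = - \<sigma> * \<mu>"
  shows "l1 = 1 / (f + g + 1) * ((f + 1) * (l + \<rho> * \<mu>) + g * \<sigma> * \<mu>)"
proof -
  have r: "r = l + (\<rho> - \<sigma>) * \<mu>" and k: "k = l1 - \<sigma> * \<mu>" using assms(5,6) by auto
  have "b * l1 = (f + 1) * (l + \<rho> * \<mu>) + g * \<sigma> * \<mu>"
    using assms(1) unfolding assms(2,3) r k by (simp add: algebra_simps)
  then show ?thesis using assms(3,4) by (simp add: field_simps)
qed

theorem theorem2p1: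
  fixes P :: "'a set" and \<B> :: "'a set set" and bs :: "'a set list"
    and b v r k l l1 l2 f g :: nat and \<rho> \<sigma> \<mu> :: real
  assumes "quasi_symmetric_design P \<B> b v r k l l1 l2"
    and "\<mu> = real l2 - real l1"
    and "Digraph_Component.connected (with_proj (block_graph \<B> l2))"
    and "distinct bs" and "set bs = \<B>"
    and "spectral_parameters (adjacency_matrix (block_graph \<B> l2) bs) = (\<rho>, \<sigma>, f, g)"
  shows
    "(v = f + 1 \<and> b = f + g + 1 \<and>
      real r - real l = (\<rho> - \<sigma>) * \<mu> \<and> real k - real l1 = - \<sigma> * \<mu>) \<and>
     (real l2 = real l1 + \<mu> \<and>
      real l1 = 1 / (real f + real g + 1) *
        ((real f + 1) * (real l + \<rho> * \<mu>) + real g * \<sigma> * \<mu>) \<and>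
      poly (balance_poly \<rho> \<sigma> f g \<mu>) (real l) = 0) \<and>
     (\<exists>b' v' r' k' l' l1' l2' :: nat.
        quasi_symmetric_design P (complement_blocks P \<B>) b' v' r' k' l' l1' l2' \<and>
        balance_poly \<rho> \<sigma> f g \<mu> = [: - real l, 1 :] * [: - real l', 1 :] \<and>
        v' = f + 1 \<and> b' = f + g + 1 \<and>
        real r' - real l' = (\<rho> - \<sigma>) * \<mu> \<and> real k' - real l1' = - \<sigma> * \<mu> \<and>
        real l2' = real l1' + \<mu> \<and>
        real l1' = 1 / (real f + real g + 1) *
          ((real f + 1) * (real l' + \<rho> * \<mu>) + real g * \<sigma> * \<mu>))"
proof -
  interpret quasi_symmetric P \<B> b v r k l l1 l2
    using assms(1) unfolding quasi_symmetric_design_def by unfold_locales auto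
  have \<mu>: "\<mu> = defect" by (simp add: assms(2) defect_def)
  note spec = spectral_parameters_block_graph[OF assms(3-5)]
  have vf: "v = f + 1" and bg: "b = f + g + 1" and \<rho>: "\<rho> = rho_ev" and \<sigma>: "\<sigma> = sigma_ev"
    using spec assms(6) two_le_v by auto
  have n: "real r - real l = (\<rho> - \<sigma>) * \<mu>" and c: "real k - real l1 = - \<sigma> * \<mu>"
    using defect_pos unfolding \<rho> \<sigma> \<mu> rho_ev_def sigma_ev_def by (simp_all add: field_simps)
  have bk: "real b * real k = real v * real r" using incidence_count by (simp flip: of_nat_mult)
  have l1: "real l1 = 1 / (real f + real g + 1) * ((real f + 1) * (real l + \<rho> * \<mu>) + real g * \<sigma> * \<mu>)"
    by (rule inter_number_formula[OF bk _ _ _ n c]) (use vf bg in simp_all)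
  define l' where "l' = b + l - 2 * r"
  note bounds = complement_bounds complement_quasi_symmetric(2)
  have l': "real l' = real b + real l - 2 * real r" using bounds by (simp add: l'_def)
  have factor: "balance_poly \<rho> \<sigma> f g \<mu> = [: - real l, 1 :] * [: - real l', 1 :]"
  proof -
    \<comment> \<open>Eliminates \<open>k\<close> between \<open>b k = v r\<close> and
      \<open>r_mult_k\<close>, leaving a quadratic relation between \<open>r\<close> and
      \<open>l\<close>.\<close>
    have "real v * (real r)\<^sup>2 = real r * (real b * real k)" by (simp add: bk power2_eq_square)
    also have "\<dots> = real b * (real r - real l + real v * real l)"
      by (simp add: mult.left_commute r_mult_k)
    finally have sq: "(real r)\<^sup>2 = real b * real l + (real r - real l) * (real b / real v)"
      using vf by (simp add: field_simps)
    have bv: "(real f + real g + 1) / (real f + 1) = real b / real v" by (simp add: vf bg add_ac)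
    \<comment> \<open>The product of the roots. Their sum is \<open>b - 2 (r - l)\<close> directly
      by \<open>l'\<close>, so both coefficients of the quadratic match.\<close>
    have "(real r - real l) * (real r - real l - real b / real v) = real l * real l'"
      using sq by (simp add: l' power2_eq_square algebra_simps)
    then show ?thesis
      unfolding balance_poly_def bv mult.assoc n[symmetric] by (simp add: l' bg algebra_simps)
  qed
  have bk': "real b * real (v - k) = real v * real (b - r)"
    using bk bounds by (simp add: algebra_simps)
  \<comment> \<open>The order \<open>r - l\<close> and the difference \<open>k - l1\<close> are
    invariant under complementation, so the same \<open>\<rho>\<close>, \<open>\<sigma>\<close> and
    \<open>\<mu>\<close> fit the complement.\<close>
  have n': "real (b - r) - real l' = (\<rho> - \<sigma>) * \<mu>" and c': "real (v - k) - real (v + l1 - 2 * k) = - \<sigma> * \<mu>"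
    using n c bounds by (simp_all add: l')
  have l1': "real (v + l1 - 2 * k) =
      1 / (real f + real g + 1) * ((real f + 1) * (real l' + \<rho> * \<mu>) + real g * \<sigma> * \<mu>)"
    by (rule inter_number_formula[OF bk' _ _ _ n' c']) (use vf bg in simp_all)
  have l2': "real (v + l2 - 2 * k) = real (v + l1 - 2 * k) + \<mu>"
    using bounds l1_less_l2 by (simp add: assms(2))
  have "poly (balance_poly \<rho> \<sigma> f g \<mu>) (real l) = 0" by (simp add: factor)
  moreover have "real l2 = real l1 + \<mu>" by (simp add: assms(2))
  moreover note complement_quasi_symmetric(1)[folded l'_def] factor n' c' l2' l1'
  ultimately show ?thesis using vf bg n c l1 by blast
qed

end
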